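(* Let $\mathcal{A}$ be a unital Banach algebra and let $a,c\in\mathcal{A}$. Then $$\sigma_*(ac)\setminus\{0\}=\sigma_*(ca)\setminus\{0\}$$ for each $*\in\{ld, rd, lg, rg, lgd, rgd\}$.
   Context: $\mathcal{A}$ is a complex unital Banach algebra, $r(\cdot)$ denotes the spectral radius, and $\mathcal{A}^{qnil}=\{a\in\mathcal{A}: r(a)=0\}$. Let $a\in\mathcal{A}$. - $a$ is left Drazin invertible if there are $x\in\mathcal{A}$ and a non-negative integer $j$ with $axa=xa^2$, $x^2a=x$, $xa^{j+1}=a^j$; it is right Drazin invertible if there are $y\in\mathcal{A}$ and a non-negative integer $j$ with $aya=a^2y$, $ay^2=y$, $a^{j+1}y=a^j$. - $a$ is left (resp. right) group invertible if the corresponding identities hold with $j=1$. - $a$ is left generalized Drazin invertible if there is $x\in\mathcal{A}$ with $axa=xa^2$, $x^2a=x$, $axa-a\in\mathcal{A}^{qnil}$; it is right generalized Drazin invertible if there is $y\in\mathcal{A}$ with $aya=a^2y$, $ay^2=y$, $aya-a\in\mathcal{A}^{qnil}$. The sets $\sigma_{ld}(a),\sigma_{rd}(a),\sigma_{lg}(a),\sigma_{rg}(a),\sigma_{lgd}(a),\sigma_{rgd}(a)$ are the sets of $\lambda\in\mathbb{C}$ such that $\lambda-a$ is not, respectively, left Drazin invertible, right Drazin invertible, left group invertible, right group invertible, left generalized Drazin invertible, right generalized Drazin invertible in $\mathcal{A}$. *)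

theory Defs
  imports Complex_Main
begin

text \<open>
  The real structure, the norm and completeness are those of the library classes;
  the norm of \<open>1\<close> is not required to be \<open>1\<close>, only the norm's submultiplicativity is assumed.
\<close>

class complex_unital_banach_algebra = real_normed_algebra + real_algebra_1 + banach +
  fixes scaleC :: "complex \<Rightarrow> 'a \<Rightarrow> 'a"  (infixr \<open>*\<^sub>C\<close> 75)
  assumes scaleC_add_right: "z *\<^sub>C (x + y) = z *\<^sub>C x + z *\<^sub>C y"
    and scaleC_add_left: "(z + w) *\<^sub>C x = z *\<^sub>C x + w *\<^sub>C x"
    and scaleC_scaleC: "z *\<^sub>C w *\<^sub>C x = (z * w) *\<^sub>C x"
    and scaleC_one: "1 *\<^sub>C x = x"
    and scaleC_of_real: "complex_of_real t *\<^sub>C x = t *\<^sub>R x"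
    and mult_scaleC_left: "(z *\<^sub>C x) * y = z *\<^sub>C (x * y)"
    and mult_scaleC_right: "x * (z *\<^sub>C y) = z *\<^sub>C (x * y)"
    and norm_scaleC: "norm (z *\<^sub>C x) = cmod z * norm x"

definition alg_invertible :: "'a::complex_unital_banach_algebra \<Rightarrow> bool" where
  "alg_invertible a \<longleftrightarrow> (\<exists>b. a * b = 1 \<and> b * a = 1)"

definition alg_spectrum :: "'a::complex_unital_banach_algebra \<Rightarrow> complex set" where
  "alg_spectrum a = {\<mu>. \<not> alg_invertible (\<mu> *\<^sub>C 1 - a)}"

text \<open>
  The supremum is taken in the reals: the spectrum is nonempty and bounded in this class,
  so it is never the unspecified value that \<^const>\<open>Sup\<close> takes on other sets.
\<close>

definition alg_spectral_radius :: "'a::complex_unital_banach_algebra \<Rightarrow> real" where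
  "alg_spectral_radius a = (SUP \<mu>\<in>alg_spectrum a. cmod \<mu>)"

definition quasinilpotents :: "'a::complex_unital_banach_algebra set" where
  "quasinilpotents = {a. alg_spectral_radius a = 0}"

definition left_drazin_identities ::
    "'a::complex_unital_banach_algebra \<Rightarrow> 'a \<Rightarrow> nat \<Rightarrow> bool" where
  "left_drazin_identities a x j \<longleftrightarrow>
     a * x * a = x * a\<^sup>2 \<and> x\<^sup>2 * a = x \<and> x * a ^ (j + 1) = a ^ j"

definition right_drazin_identities ::
    "'a::complex_unital_banach_algebra \<Rightarrow> 'a \<Rightarrow> nat \<Rightarrow> bool" where
  "right_drazin_identities a y j \<longleftrightarrow>
     a * y * a = a\<^sup>2 * y \<and> a * y\<^sup>2 = y \<and> a ^ (j + 1) * y = a ^ j"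

definition left_drazin_invertible :: "'a::complex_unital_banach_algebra \<Rightarrow> bool" where
  "left_drazin_invertible a \<longleftrightarrow> (\<exists>x j. left_drazin_identities a x j)"

definition right_drazin_invertible :: "'a::complex_unital_banach_algebra \<Rightarrow> bool" where
  "right_drazin_invertible a \<longleftrightarrow> (\<exists>y j. right_drazin_identities a y j)"

definition left_group_invertible :: "'a::complex_unital_banach_algebra \<Rightarrow> bool" where
  "left_group_invertible a \<longleftrightarrow> (\<exists>x. left_drazin_identities a x 1)"

definition right_group_invertible :: "'a::complex_unital_banach_algebra \<Rightarrow> bool" where
  "right_group_invertible a \<longleftrightarrow> (\<exists>y. right_drazin_identities a y 1)"

definition left_gen_drazin_invertible :: "'a::complex_unital_banach_algebra \<Rightarrow> bool" where
  "left_gen_drazin_invertible a \<longleftrightarrow>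
     (\<exists>x. a * x * a = x * a\<^sup>2 \<and> x\<^sup>2 * a = x \<and> a * x * a - a \<in> quasinilpotents)"

definition right_gen_drazin_invertible :: "'a::complex_unital_banach_algebra \<Rightarrow> bool" where
  "right_gen_drazin_invertible a \<longleftrightarrow>
     (\<exists>y. a * y * a = a\<^sup>2 * y \<and> a * y\<^sup>2 = y \<and> a * y * a - a \<in> quasinilpotents)"

definition sigma_ld :: "'a::complex_unital_banach_algebra \<Rightarrow> complex set" where
  "sigma_ld a = {\<mu>. \<not> left_drazin_invertible (\<mu> *\<^sub>C 1 - a)}"

definition sigma_rd :: "'a::complex_unital_banach_algebra \<Rightarrow> complex set" where
  "sigma_rd a = {\<mu>. \<not> right_drazin_invertible (\<mu> *\<^sub>C 1 - a)}"

definition sigma_lg :: "'a::complex_unital_banach_algebra \<Rightarrow> complex set" where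
  "sigma_lg a = {\<mu>. \<not> left_group_invertible (\<mu> *\<^sub>C 1 - a)}"

definition sigma_rg :: "'a::complex_unital_banach_algebra \<Rightarrow> complex set" where
  "sigma_rg a = {\<mu>. \<not> right_group_invertible (\<mu> *\<^sub>C 1 - a)}"

definition sigma_lgd :: "'a::complex_unital_banach_algebra \<Rightarrow> complex set" where
  "sigma_lgd a = {\<mu>. \<not> left_gen_drazin_invertible (\<mu> *\<^sub>C 1 - a)}"

definition sigma_rgd :: "'a::complex_unital_banach_algebra \<Rightarrow> complex set" where
  "sigma_rgd a = {\<mu>. \<not> right_gen_drazin_invertible (\<mu> *\<^sub>C 1 - a)}"

end

theory Submission
  imports Defs
begin

text \<open>
  A one-sided Drazin inverse of \<open>a\<close> amounts to an idempotent \<open>e\<close> commuting with \<open>a\<close> that splits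
  \<open>a\<close> into two blocks: on the complementary idempotent \<open>1 - e\<close> the element is one-sided
  invertible, which just says \<open>1 - e = x * a\<close> (left case) or \<open>1 - e = a * y\<close> (right case), and the
  remaining block \<open>e * a\<close> is small: zero for group invertibility, nilpotent for Drazin
  invertibility, quasinilpotent for generalized Drazin invertibility. This is the content of the
  lemmas \<open>left_drazin_iff\<close>, \<open>left_group_iff\<close>, \<open>left_gen_drazin_iff\<close> and their right-hand mirrors.

  It then suffices to carry such an idempotent from \<open>m - a * c\<close> to \<open>m - c * a\<close>, where \<open>m\<close> is a nonzero
  scalar, in the spirit of Jacobson's lemma. Put \<open>w = e * (m - a * c)\<close>. As \<open>w\<close> is small, \<open>m - w\<close>
  has an inverse \<open>u\<close>, and since \<open>a * c * e = (m - w) * e\<close>, the product \<open>a * c\<close> is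
  invertible on the range of \<open>e\<close> with inverse \<open>e * u\<close>. Hence \<open>f = c * e * u * a\<close> is an
  idempotent, the image of \<open>e\<close> under the similarity between \<open>a * c\<close> and \<open>c * a\<close> on these ranges.
  It commutes with \<open>m - c * a\<close> and its small block is
  \<open>f * (m - c * a) = c * w * (u * a)\<close> while \<open>w * (u * a) * c = w\<close>; smallness passes from \<open>w\<close> to that
  element without any change of the nilpotency index. The explicit one-sided inverse
  \<open>1 + c * x * a\<close> of Jacobson's lemma, cut down by \<open>1 - f\<close>, inverts the complementary block up to \<open>m\<close>
  (\<open>splitting_transport\<close>).

  The spectral input is slight. Boundedness of the spectrum (by the Neumann series) turns spectral
  radius \<open>0\<close> into the absence of nonzero spectral points. Passing back would need a nonempty
  spectrum, but the case of an empty one can be avoided: if \<open>e * a\<close> is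
  invertible, so is \<open>a\<close>, and the splitting with \<open>e = 0\<close> has the small block \<open>0\<close>.
\<close>

section \<open>Spectral idempotents and Jacobson's lemma in rings\<close>

lemma commute_inverse:
  fixes u v z :: "'a::ring_1"
  assumes "u * v = 1" "v * u = 1" "v * z = z * v"
  shows "u * z = z * u"
proof -
  have "u * z = u * z * (v * u)" using assms by simp
  also have "\<dots> = u * (z * v) * u" by (simp add: mult.assoc)
  also have "\<dots> = (u * v) * z * u" using assms(3) by (simp add: mult.assoc)
  finally show ?thesis using assms(1) by simp
qed

text \<open>
  The element \<open>f\<close> is the idempotent for \<open>m - c * a\<close> that corresponds to \<open>e\<close>; all conclusions
  rest on \<open>e * u * a * c = e = a * c * e * u\<close>. Because of the last two, \<open>1 - f\<close> annihilates
  \<open>c * e * a\<close>, which is the error that remains when Jacobson's formula is applied to a one-sided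
  inverse of the complementary block only.
\<close>

lemma transported_idempotent:
  fixes a c e u m w f :: "'a::ring_1"
  assumes central: "\<And>z. m * z = z * m"
    and idem: "e * e = e"
    and comm: "(m - a * c) * e = e * (m - a * c)"
    and w: "w = e * (m - a * c)"
    and inv: "u * (m - w) = 1" "(m - w) * u = 1"
    and f: "f = c * e * u * a"
  shows "f * f = f"
    and "f * (m - c * a) = c * w * (u * a)"
    and "(m - c * a) * f = c * w * (u * a)"
    and "w * (u * a) * c = w"
    and "f * (c * e * a) = c * e * a"
    and "(c * e * a) * f = c * e * a"
proof -
  define T where "T = a * c"
  have Te: "T * e = e * T"
    using comm central[of e] by (simp add: T_def algebra_simps)
  have eT: "e * T = e * (m - w)"
  proof -
    have "e * w = w" using idem by (simp add: w mult.assoc[symmetric])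
    then show ?thesis by (simp add: right_diff_distrib w T_def)
  qed
  have wT: "w * T = T * w"
  proof -
    have "w * T = e * (T * (m - T))"
      by (simp add: w T_def[symmetric] mult.assoc left_diff_distrib right_diff_distrib central)
    then show ?thesis by (simp add: Te[symmetric] w T_def[symmetric] mult.assoc[symmetric])
  qed
  have we: "w * e = e * w"
    using comm by (simp add: w mult.assoc)
  have uT: "u * T = T * u"
    by (rule commute_inverse[OF inv]) (simp add: algebra_simps wT central)
  have ue: "u * e = e * u"
    by (rule commute_inverse[OF inv]) (simp add: algebra_simps we central)
  \<comment> \<open>On the range of \<open>e\<close> the element \<open>a * c\<close> is invertible, with inverse \<open>e * u\<close>.\<close>
  have Teu: "T * e * u = e"
    using eT inv by (simp add: Te mult.assoc)
  have euT: "e * u * T = e"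
    using Teu Te uT by (metis mult.assoc)
  have eu_ac: "e * (u * (a * (c * z))) = e * z" for z
    using euT by (metis T_def mult.assoc)
  have ac_eu: "a * (c * (e * (u * z))) = e * z" for z
    using Teu by (metis T_def mult.assoc)
  have alpha: "(m - T) * u = u * (m - T)"
    by (simp add: algebra_simps uT central)
  have ee: "e * (e * z) = e * z" for z using idem by (metis mult.assoc)
  show "f * f = f"
    by (simp add: f mult.assoc eu_ac ee)
  have 1: "a * (m - c * a) = (m - T) * a" "(m - c * a) * c = c * (m - T)"
    by (simp_all add: algebra_simps T_def central)
  have "f * (m - c * a) = c * e * u * ((m - T) * a)"
    by (simp add: f 1(1) mult.assoc)
  also have "\<dots> = c * e * ((m - T) * u) * a"
    by (simp only: alpha) (simp add: mult.assoc)
  finally show "f * (m - c * a) = c * w * (u * a)"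
    by (simp add: w T_def mult.assoc)
  have "(m - c * a) * f = c * ((m - T) * e) * u * a"
    by (simp add: f 1(2) mult.assoc[symmetric])
  then show "(m - c * a) * f = c * w * (u * a)"
    by (simp add: w T_def comm mult.assoc)
  have "w * (u * a) * c = (m - T) * (e * u * T)"
    by (simp add: w T_def comm[symmetric] mult.assoc)
  then show "w * (u * a) * c = w"
    unfolding euT using comm by (simp add: w T_def)
  show "f * (c * e * a) = c * e * a"
    by (simp add: f mult.assoc eu_ac ee)
  show "(c * e * a) * f = c * e * a"
    by (simp add: f mult.assoc ac_eu ee)
qed

section \<open>Scalars, invertibility and the spectrum\<close>

lemma scalar_central:
  "(\<mu> *\<^sub>C 1) * z = z * (\<mu> *\<^sub>C (1::'a::complex_unital_banach_algebra))"
  by (simp add: mult_scaleC_left mult_scaleC_right)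

lemma scalar_inverse:
  assumes "\<mu> \<noteq> 0"
  shows "(inverse \<mu> *\<^sub>C 1) * (\<mu> *\<^sub>C (1::'a::complex_unital_banach_algebra)) = 1"
  using assms by (simp add: mult_scaleC_left scaleC_scaleC scaleC_one)

lemma alg_invertible_scalar:
  assumes "\<mu> \<noteq> 0"
  shows "alg_invertible (\<mu> *\<^sub>C (1::'a::complex_unital_banach_algebra))"
  unfolding alg_invertible_def using scalar_inverse[OF assms] scalar_central by metis

lemma alg_invertible_uminus:
  assumes "alg_invertible a"
  shows "alg_invertible (- a)"
  using assms unfolding alg_invertible_def by (metis minus_mult_minus)

lemma alg_invertible_mult:
  assumes "alg_invertible a" "alg_invertible b"
  shows "alg_invertible (a * b)"
proof -
  obtain a' b' where "a * a' = 1" "a' * a = 1" "b * b' = 1" "b' * b = 1"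
    using assms unfolding alg_invertible_def by blast
  then have "(a * b) * (b' * a') = 1" "(b' * a') * (a * b) = 1"
    by (metis mult.assoc mult_1_left)+
  then show ?thesis unfolding alg_invertible_def by blast
qed

lemma alg_invertible_cancel_commuting:
  assumes "x * y = y * x" "alg_invertible (x * y)"
  shows "alg_invertible x"
proof -
  obtain b where b: "x * y * b = 1" "b * (x * y) = 1"
    using assms(2) unfolding alg_invertible_def by blast
  have "b * y * x = 1" using b(2) assms(1) by (simp add: mult.assoc)
  moreover have "x * (y * b) = 1" using b(1) by (simp add: mult.assoc)
  ultimately have "b * y = y * b" by (metis mult.assoc mult_1_left mult_1_right)
  then show ?thesis
    using \<open>b * y * x = 1\<close> \<open>x * (y * b) = 1\<close> unfolding alg_invertible_def by metis
qed

text \<open>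
  Jacobson's lemma for invertibility: up to the factor \<open>\<mu>\<close>, the inverse on the other side is
  \<open>1 + y * b * x\<close>, with \<open>b\<close> the given inverse.
\<close>

lemma alg_invertible_swap:
  assumes "\<mu> \<noteq> 0" "alg_invertible (\<mu> *\<^sub>C 1 - x * y)"
  shows "alg_invertible (\<mu> *\<^sub>C 1 - y * x)"
proof -
  define m where "m = \<mu> *\<^sub>C (1::'a)"
  obtain b where b: "(m - x * y) * b = 1" "b * (m - x * y) = 1"
    using assms(2) unfolding alg_invertible_def m_def by blast
  have central: "m * z = z * m" for z by (simp add: m_def scalar_central)
  have "(m - y * x) * (1 + y * b * x) = (m - y * x) + y * ((m - x * y) * b) * x"
    by (simp add: algebra_simps central)
  then have 1: "(m - y * x) * (1 + y * b * x) = m" by (simp add: b)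
  have "(1 + y * b * x) * (m - y * x) = (m - y * x) + y * (b * (m - x * y)) * x"
    by (simp add: algebra_simps central)
  then have 2: "(1 + y * b * x) * (m - y * x) = m" by (simp add: b)
  have "alg_invertible ((m - y * x) * (1 + y * b * x))"
    using 1 alg_invertible_scalar[OF assms(1)] by (simp add: m_def)
  then show ?thesis
    using alg_invertible_cancel_commuting 1 2 by (metis m_def)
qed

text \<open>
  The Neumann series. In this class the norm of \<open>1\<close> is arbitrary, so the geometric bound on
  \<open>norm (b ^ n)\<close> holds from \<open>n = 1\<close> on only, and the comparison is made on the shifted series.
\<close>

lemma alg_invertible_one_minus_small:
  fixes b :: "'a::complex_unital_banach_algebra"
  assumes "norm b < 1"
  shows "alg_invertible (1 - b)"
proof -
  have le: "norm (b ^ Suc n) \<le> norm b ^ Suc n" for n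
  proof (induction n)
    case (Suc n)
    have "norm (b ^ Suc (Suc n)) \<le> norm b * norm (b ^ Suc n)"
      by (metis norm_mult_ineq power_Suc)
    also have "\<dots> \<le> norm b * norm b ^ Suc n"
      using Suc by (simp add: mult_left_mono)
    finally show ?case by simp
  qed simp
  have "summable (\<lambda>n. norm b ^ Suc n)"
    using assms by (simp add: summable_geometric summable_mult)
  then have "summable (\<lambda>n. b ^ Suc n)"
    using le by (rule summable_comparison_test')
  then have sm: "summable (\<lambda>n. b ^ n)" using summable_Suc_iff by blast
  have "(\<lambda>n. b ^ n - b ^ Suc n) sums (b ^ 0 - 0)"
    by (rule telescope_sums') (rule summable_LIMSEQ_zero[OF sm])
  then have s: "(\<lambda>n. b ^ n - b ^ Suc n) sums 1" by simp
  have "(\<lambda>n. (1 - b) * b ^ n) = (\<lambda>n. b ^ n - b ^ Suc n)"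
    "(\<lambda>n. b ^ n * (1 - b)) = (\<lambda>n. b ^ n - b ^ Suc n)"
    by (auto simp: algebra_simps power_commutes)
  then have "(1 - b) * (\<Sum>n. b ^ n) = 1" "(\<Sum>n. b ^ n) * (1 - b) = 1"
    using s sm by (metis suminf_mult sums_unique, metis suminf_mult2 sums_unique)
  then show ?thesis unfolding alg_invertible_def by blast
qed

lemma bdd_above_alg_spectrum: "bdd_above (cmod ` alg_spectrum a)"
proof (rule bdd_aboveI2)
  fix \<mu> assume \<mu>: "\<mu> \<in> alg_spectrum a"
  show "cmod \<mu> \<le> norm a"
  proof (rule ccontr)
    assume "\<not> cmod \<mu> \<le> norm a"
    then have lt: "norm a < cmod \<mu>" by simp
    then have "\<mu> \<noteq> 0" using norm_ge_zero[of a] by force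
    have "norm (inverse \<mu> *\<^sub>C a) < 1"
      using lt by (simp add: norm_scaleC norm_inverse) (simp add: divide_simps)
    then have "alg_invertible ((\<mu> *\<^sub>C 1) * (1 - inverse \<mu> *\<^sub>C a))"
      using alg_invertible_mult alg_invertible_scalar alg_invertible_one_minus_small \<open>\<mu> \<noteq> 0\<close>
      by blast
    moreover have "(\<mu> *\<^sub>C 1) * (1 - inverse \<mu> *\<^sub>C a) = \<mu> *\<^sub>C 1 - a"
      using \<open>\<mu> \<noteq> 0\<close>
      by (simp add: right_diff_distrib mult_scaleC_left scaleC_scaleC scaleC_one)
    ultimately show False using \<mu> by (simp add: alg_spectrum_def)
  qed
qed

text \<open>
  Quasinilpotency freed from the supremum over the spectrum: this property passes from \<open>x * y\<close> to
  \<open>y * x\<close> without any appeal to nonemptiness of the spectrum.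
\<close>

definition no_nonzero_spectrum :: "'a::complex_unital_banach_algebra \<Rightarrow> bool" where
  "no_nonzero_spectrum w \<longleftrightarrow> (\<forall>\<mu>. \<mu> \<noteq> 0 \<longrightarrow> alg_invertible (\<mu> *\<^sub>C 1 - w))"

lemma no_nonzero_spectrum_uminus:
  assumes "no_nonzero_spectrum w"
  shows "no_nonzero_spectrum (- w)"
  unfolding no_nonzero_spectrum_def
proof (intro allI impI)
  fix \<mu> :: complex assume "\<mu> \<noteq> 0"
  then have "alg_invertible (- ((- \<mu>) *\<^sub>C 1 - w))"
    using assms alg_invertible_uminus unfolding no_nonzero_spectrum_def
    by (metis neg_equal_0_iff_equal)
  moreover have "(- \<mu>) *\<^sub>C (1::'a) = - (\<mu> *\<^sub>C 1)"
    using scaleC_add_left[of "-\<mu>" \<mu> "1::'a"] scaleC_of_real[of 0 "1::'a"]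
    by (simp add: eq_neg_iff_add_eq_0)
  ultimately show "alg_invertible (\<mu> *\<^sub>C 1 - - w)" by (simp add: add.commute)
qed

lemma quasinilpotent_no_nonzero_spectrum:
  assumes "w \<in> quasinilpotents"
  shows "no_nonzero_spectrum w"
  unfolding no_nonzero_spectrum_def
proof (intro allI impI, rule ccontr)
  fix \<mu> :: complex assume "\<mu> \<noteq> 0" "\<not> alg_invertible (\<mu> *\<^sub>C 1 - w)"
  then have "cmod \<mu> \<le> alg_spectral_radius w"
    unfolding alg_spectral_radius_def
    by (intro cSUP_upper bdd_above_alg_spectrum) (simp add: alg_spectrum_def)
  then show False using assms \<open>\<mu> \<noteq> 0\<close> by (simp add: quasinilpotents_def)
qed

text \<open>
  Non-invertibility puts \<open>0\<close> into the spectrum, so that the supremum is over \<open>{0}\<close>.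
\<close>

lemma quasinilpotentI:
  assumes "no_nonzero_spectrum w" "\<not> alg_invertible w"
  shows "w \<in> quasinilpotents"
proof -
  have z: "0 *\<^sub>C (1::'a) = 0" using scaleC_of_real[of 0 "1::'a"] by simp
  have "alg_invertible (- w) \<Longrightarrow> False"
    using assms(2) alg_invertible_uminus by fastforce
  then have "alg_spectrum w = {0}"
    using assms(1) by (auto simp: alg_spectrum_def no_nonzero_spectrum_def z)
  then show ?thesis by (simp add: quasinilpotents_def alg_spectral_radius_def)
qed

text \<open>
  The factorisation \<open>m ^ k - w ^ k = (m - w) * s\<close>, with \<open>m\<close> central and \<open>s\<close> commuting with
  \<open>m - w\<close>, has the invertible left side \<open>m ^ k\<close> as soon as \<open>w ^ k = 0\<close>.
\<close>

lemma no_nonzero_spectrum_nilpotent: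
  fixes w :: "'a::complex_unital_banach_algebra"
  assumes "w ^ Suc n = 0"
  shows "no_nonzero_spectrum w"
  unfolding no_nonzero_spectrum_def
proof (intro allI impI)
  fix \<mu> :: complex assume "\<mu> \<noteq> 0"
  define m where "m = \<mu> *\<^sub>C (1::'a)"
  have central: "m * z = z * m" for z by (simp add: m_def scalar_central)
  have "\<exists>s. (m - w) * s = m ^ k - w ^ k \<and> s * (m - w) = m ^ k - w ^ k" for k
  proof (induction k)
    case 0
    show ?case by (rule exI[of _ 0]) simp
  next
    case (Suc k)
    then obtain s where s: "(m - w) * s = m ^ k - w ^ k" "s * (m - w) = m ^ k - w ^ k" by blast
    have "(m - w) * (m * s + w ^ k) = m * ((m - w) * s) + (m - w) * w ^ k"
      by (simp add: distrib_left) (metis central mult.assoc)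
    moreover have "(m * s + w ^ k) * (m - w) = m * (s * (m - w)) + w ^ k * (m - w)"
      by (simp add: distrib_right mult.assoc)
    ultimately show ?case
      by (intro exI[of _ "m * s + w ^ k"])
        (simp only: s, simp add: right_diff_distrib left_diff_distrib power_commutes central[of "w ^ k"])
  qed
  then obtain s where s: "(m - w) * s = m ^ Suc n" "s * (m - w) = m ^ Suc n"
    using assms by (metis diff_zero)
  have "alg_invertible (m ^ k)" for k
  proof (induction k)
    case 0
    show ?case unfolding alg_invertible_def by (metis mult_1_left power_0)
  next
    case (Suc k)
    then show ?case
      unfolding power_Suc m_def
      using alg_invertible_mult alg_invertible_scalar[OF \<open>\<mu> \<noteq> 0\<close>] by blast
  qed
  then have "alg_invertible ((m - w) * s)" using s by metis
  then show "alg_invertible (\<mu> *\<^sub>C 1 - w)"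
    using alg_invertible_cancel_commuting s by (metis m_def)
qed

section \<open>Left and right splittings\<close>

text \<open>
  \<open>1 - e\<close> and \<open>e\<close> are the units of the two corners in which \<open>a\<close> is, respectively, one-sided
  invertible and small; smallness is left as a parameter \<open>P\<close>.
\<close>

definition left_splitting ::
    "('a::complex_unital_banach_algebra \<Rightarrow> bool) \<Rightarrow> 'a \<Rightarrow> bool" where
  "left_splitting P a \<longleftrightarrow>
     (\<exists>e x. e * e = e \<and> a * e = e * a \<and> x * a = 1 - e \<and> P (e * a))"

definition right_splitting ::
    "('a::complex_unital_banach_algebra \<Rightarrow> bool) \<Rightarrow> 'a \<Rightarrow> bool" where
  "right_splitting P a \<longleftrightarrow>
     (\<exists>e y. e * e = e \<and> a * e = e * a \<and> a * y = 1 - e \<and> P (e * a))"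

text \<open>
  What a notion of smallness has to satisfy: small elements have no nonzero spectrum, so that
  \<open>m - w\<close> is invertible, and \<open>P\<close> passes to the small block \<open>c * w * t\<close> of the transported
  idempotent. The condition \<open>w * t * c = w\<close> is what makes
  being zero transportable: \<open>x * y = 0\<close> alone does not give \<open>y * x = 0\<close>.
\<close>

definition transportable :: "('a::complex_unital_banach_algebra \<Rightarrow> bool) \<Rightarrow> bool" where
  "transportable P \<longleftrightarrow>
     (\<forall>w. P w \<longrightarrow> no_nonzero_spectrum w) \<and>
     (\<forall>c w t. P w \<longrightarrow> w * t * c = w \<longrightarrow> P (c * w * t))"

lemma splitting_transport:
  fixes a c :: "'a::complex_unital_banach_algebra"
  assumes P: "transportable P" and "\<mu> \<noteq> 0"
  shows "left_splitting P (\<mu> *\<^sub>C 1 - a * c) \<Longrightarrow> left_splitting P (\<mu> *\<^sub>C 1 - c * a)"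
    and "right_splitting P (\<mu> *\<^sub>C 1 - a * c) \<Longrightarrow> right_splitting P (\<mu> *\<^sub>C 1 - c * a)"
proof -
  define m where "m = \<mu> *\<^sub>C (1::'a)"
  define k where "k = inverse \<mu> *\<^sub>C (1::'a)"
  have central: "m * z = z * m" "k * z = z * k" for z
    by (simp_all add: m_def k_def scalar_central)
  have km: "k * m = 1" using scalar_inverse[OF \<open>\<mu> \<noteq> 0\<close>] by (simp add: m_def k_def)
  \<comment> \<open>The part of the argument that does not depend on the side: only the one-sided inverse of
      the complementary block distinguishes left from right.\<close>
  have core: "\<exists>f. f * f = f \<and> (m - c * a) * f = f * (m - c * a) \<and> P (f * (m - c * a)) \<and>
      (1 - f) * (m - c * e * a) = m * (1 - f) \<and> (m - c * e * a) * (1 - f) = m * (1 - f)"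
    if e: "e * e = e" "(m - a * c) * e = e * (m - a * c)" "P (e * (m - a * c))" for e
  proof -
    define w where "w = e * (m - a * c)"
    obtain u where u: "u * (m - w) = 1" "(m - w) * u = 1"
      using P e(3) \<open>\<mu> \<noteq> 0\<close>
      unfolding transportable_def no_nonzero_spectrum_def alg_invertible_def m_def w_def by blast
    define f where "f = c * e * u * a"
    note f = transported_idempotent[OF central(1) e(1,2) w_def u f_def]
    have "P (f * (m - c * a))"
      using P e(3) f(2,4) unfolding transportable_def w_def by metis
    moreover have "(1 - f) * (m - c * e * a) = m * (1 - f)"
      "(m - c * e * a) * (1 - f) = m * (1 - f)"
      using f(5,6) by (simp_all add: left_diff_distrib right_diff_distrib central)
    ultimately show ?thesis using f(1-3) by metis
  qed
  show "left_splitting P (\<mu> *\<^sub>C 1 - c * a)" if L: "left_splitting P (\<mu> *\<^sub>C 1 - a * c)"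
  proof -
    obtain e x where e: "e * e = e" "(m - a * c) * e = e * (m - a * c)" "P (e * (m - a * c))"
      and x: "x * (m - a * c) = 1 - e"
      using L unfolding left_splitting_def m_def by blast
    obtain f where f: "f * f = f" "(m - c * a) * f = f * (m - c * a)" "P (f * (m - c * a))"
      "(1 - f) * (m - c * e * a) = m * (1 - f)"
      using core[OF e] by blast
    have "(1 + c * x * a) * (m - c * a) = m - c * a + c * (x * (m - a * c)) * a"
      by (simp add: algebra_simps central)
    also have "\<dots> = m - c * e * a" unfolding x by (simp add: algebra_simps)
    finally have "k * (1 - f) * (1 + c * x * a) * (m - c * a) = k * m * (1 - f)"
      using f(4) by (simp only: mult.assoc)
    then show ?thesis
      using f(1-3) km unfolding left_splitting_def m_def by (metis mult_1_left)
  qed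
  show "right_splitting P (\<mu> *\<^sub>C 1 - c * a)" if R: "right_splitting P (\<mu> *\<^sub>C 1 - a * c)"
  proof -
    obtain e y where e: "e * e = e" "(m - a * c) * e = e * (m - a * c)" "P (e * (m - a * c))"
      and y: "(m - a * c) * y = 1 - e"
      using R unfolding right_splitting_def m_def by blast
    obtain f where f: "f * f = f" "(m - c * a) * f = f * (m - c * a)" "P (f * (m - c * a))"
      "(m - c * e * a) * (1 - f) = m * (1 - f)"
      using core[OF e] by blast
    have "(m - c * a) * (1 + c * y * a) = m - c * a + c * ((m - a * c) * y) * a"
      by (simp add: algebra_simps central)
    also have "\<dots> = m - c * e * a" unfolding y by (simp add: algebra_simps)
    finally have "(m - c * a) * ((1 + c * y * a) * (1 - f) * k) = m * (1 - f) * k"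
      using f(4) by (metis mult.assoc)
    also have "\<dots> = 1 - f" using km central by (metis mult.assoc mult_1_left)
    finally show ?thesis
      using f(1-3) unfolding right_splitting_def m_def by blast
  qed
qed

lemma transportable_zero: "transportable (\<lambda>w. w = 0)"
  unfolding transportable_def using no_nonzero_spectrum_nilpotent[of 0 0] by simp

lemma transportable_nilpotent: "transportable (\<lambda>w. \<exists>n. w ^ Suc n = 0)"
  unfolding transportable_def
proof (intro conjI allI impI)
  fix c w t :: 'a assume "\<exists>n. w ^ Suc n = 0" and wtc: "w * t * c = w"
  then obtain n where n: "w ^ Suc n = 0" by blast
  have "(c * w * t) ^ Suc k = c * w ^ Suc k * t" for k
  proof (induction k)
    case (Suc k)
    have "(c * w * t) ^ Suc (Suc k) = c * (w * t * c) * w ^ Suc k * t"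
      unfolding power_Suc[of _ "Suc k"] Suc by (simp only: mult.assoc)
    then show ?case unfolding wtc power_Suc[of _ "Suc k"] by (simp only: mult.assoc)
  qed simp
  then have "(c * w * t) ^ Suc n = 0" using n by simp
  then show "\<exists>n. (c * w * t) ^ Suc n = 0" by blast
qed (use no_nonzero_spectrum_nilpotent in blast)

lemma transportable_no_nonzero_spectrum: "transportable no_nonzero_spectrum"
  unfolding transportable_def no_nonzero_spectrum_def
  by (metis alg_invertible_swap mult.assoc)

section \<open>One-sided Drazin inverses as splittings\<close>

text \<open>
  The first identity says that \<open>x * a\<close> commutes with \<open>a\<close>; together with the second one it makes
  \<open>x * a\<close> idempotent.
\<close>

lemma left_identities_splitting:
  fixes a x :: "'a::ring_1"
  assumes "a * x * a = x * a\<^sup>2" "x\<^sup>2 * a = x"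
  defines "e \<equiv> 1 - x * a"
  shows "e * e = e" "a * e = e * a" "x * a = 1 - e" "e * a = - (a * x * a - a)"
proof -
  have "x * a * (x * a) = x * (a * x * a)" by (simp add: mult.assoc)
  also have "\<dots> = x\<^sup>2 * a * a" by (simp only: assms(1)) (simp add: power2_eq_square mult.assoc)
  finally have "x * a * (x * a) = x * a" by (simp add: assms(2))
  then show "e * e = e" by (simp add: e_def algebra_simps)
  show "a * e = e * a" "x * a = 1 - e" "e * a = - (a * x * a - a)"
    using assms(1) by (simp_all add: e_def algebra_simps power2_eq_square)
qed

lemma right_identities_splitting:
  fixes a y :: "'a::ring_1"
  assumes "a * y * a = a\<^sup>2 * y" "a * y\<^sup>2 = y"
  defines "e \<equiv> 1 - a * y"
  shows "e * e = e" "a * e = e * a" "a * y = 1 - e" "e * a = - (a * y * a - a)"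
proof -
  have "a * y * (a * y) = a * y * a * y" by (simp add: mult.assoc)
  also have "\<dots> = a * (a * y\<^sup>2)" by (simp only: assms(1)) (simp add: power2_eq_square mult.assoc)
  finally have "a * y * (a * y) = a * y" by (simp add: assms(2))
  then show "e * e = e" by (simp add: e_def algebra_simps)
  show "a * e = e * a" "a * y = 1 - e" "e * a = - (a * y * a - a)"
    using assms(1) by (simp_all add: e_def algebra_simps power2_eq_square)
qed

text \<open>
  The last identity forces \<open>x' * e = 0\<close>, which need not hold for \<open>x\<close>; compressing \<open>x\<close> by \<open>1 - e\<close>
  achieves it and keeps \<open>x * a\<close> unchanged.
\<close>

lemma left_splitting_identities:
  fixes a e x :: "'a::ring_1"
  assumes "e * e = e" "a * e = e * a" "x * a = 1 - e"
  defines "x' \<equiv> (1 - e) * x * (1 - e)"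
  shows "x' * a = 1 - e" "a * x' * a = x' * a\<^sup>2" "x'\<^sup>2 * a = x'"
proof -
  have pp: "(1 - e) * (1 - e) = 1 - e" using assms(1) by (simp add: algebra_simps)
  have pa: "(1 - e) * a = a * (1 - e)" using assms(2) by (simp add: algebra_simps)
  have "x' * a = (1 - e) * (x * a) * (1 - e)" by (simp add: x'_def pa mult.assoc)
  then show xa: "x' * a = 1 - e" by (simp add: assms(3) pp)
  then show "a * x' * a = x' * a\<^sup>2"
    using pa by (simp add: power2_eq_square mult.assoc[symmetric]) (simp add: mult.assoc)
  have "x'\<^sup>2 * a = x' * (1 - e)" by (simp add: power2_eq_square mult.assoc xa)
  then show "x'\<^sup>2 * a = x'" by (simp add: x'_def mult.assoc pp)
qed

text \<open>
  Here the compression achieves \<open>e * y' = 0\<close>, again forced by the last identity.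
\<close>

lemma right_splitting_identities:
  fixes a e y :: "'a::ring_1"
  assumes "e * e = e" "a * e = e * a" "a * y = 1 - e"
  defines "y' \<equiv> (1 - e) * y * (1 - e)"
  shows "a * y' = 1 - e" "a * y' * a = a\<^sup>2 * y'" "a * y'\<^sup>2 = y'"
proof -
  have pp: "(1 - e) * (1 - e) = 1 - e" using assms(1) by (simp add: algebra_simps)
  have pa: "(1 - e) * a = a * (1 - e)" using assms(2) by (simp add: algebra_simps)
  have "a * y' = (1 - e) * (a * y) * (1 - e)"
    by (simp add: y'_def mult.assoc[symmetric] pa)
  then show ay: "a * y' = 1 - e" by (simp add: assms(3) pp)
  then show "a * y' * a = a\<^sup>2 * y'" using pa by (simp add: power2_eq_square mult.assoc)
  have "a * y'\<^sup>2 = (1 - e) * y'" by (simp add: power2_eq_square mult.assoc[symmetric] ay)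
  then show "a * y'\<^sup>2 = y'" by (simp add: y'_def mult.assoc[symmetric] pp)
qed

lemma idempotent_times_power:
  fixes a e :: "'a::ring_1"
  assumes "e * e = e" "a * e = e * a"
  shows "(e * a) ^ Suc n = e * a ^ Suc n" "a ^ n * e = e * a ^ n"
proof -
  show c: "a ^ n * e = e * a ^ n" for n
  proof (induction n)
    case (Suc n)
    then show ?case using assms(2) by (metis mult.assoc power_Suc)
  qed simp
  show "(e * a) ^ Suc n = e * a ^ Suc n"
  proof (induction n)
    case (Suc n)
    have "(e * a) ^ Suc (Suc n) = e * (a * e) * a ^ Suc n"
      by (simp only: power_Suc[of _ "Suc n"] Suc mult.assoc)
    also have "\<dots> = e * e * a * a ^ Suc n" by (simp only: assms(2) mult.assoc)
    finally show ?case by (simp add: assms(1) mult.assoc)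
  qed simp
qed

lemma left_drazin_identities_splitting:
  assumes "left_drazin_identities a x j"
  obtains e where "e * e = e" "a * e = e * a" "x * a = 1 - e" "e * a ^ j = 0"
proof
  have i: "a * x * a = x * a\<^sup>2" "x\<^sup>2 * a = x" "x * a ^ (j + 1) = a ^ j"
    using assms by (auto simp: left_drazin_identities_def)
  show "(1 - x * a) * (1 - x * a) = 1 - x * a" "a * (1 - x * a) = (1 - x * a) * a"
    "x * a = 1 - (1 - x * a)"
    using left_identities_splitting[OF i(1,2)] by auto
  show "(1 - x * a) * a ^ j = 0" using i(3) by (simp add: algebra_simps)
qed

lemma right_drazin_identities_splitting:
  assumes "right_drazin_identities a y j"
  obtains e where "e * e = e" "a * e = e * a" "a * y = 1 - e" "a ^ j * e = 0"
proof
  have i: "a * y * a = a\<^sup>2 * y" "a * y\<^sup>2 = y" "a ^ (j + 1) * y = a ^ j"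
    using assms by (auto simp: right_drazin_identities_def)
  show "(1 - a * y) * (1 - a * y) = 1 - a * y" "a * (1 - a * y) = (1 - a * y) * a"
    "a * y = 1 - (1 - a * y)"
    using right_identities_splitting[OF i(1,2)] by auto
  have "a ^ j * (a * y) = a ^ j" using i(3) by (metis Suc_eq_plus1 mult.assoc power_Suc2)
  then show "a ^ j * (1 - a * y) = 0" by (simp add: right_diff_distrib)
qed

lemma splitting_left_drazin_identities:
  assumes "e * e = e" "a * e = e * a" "x * a = 1 - e" "e * a ^ j = 0"
  shows "\<exists>x. left_drazin_identities a x j"
proof -
  note i = left_splitting_identities[OF assms(1-3)]
  have "(1 - e) * x * (1 - e) * a ^ (j + 1) = (1 - e) * a ^ j"
    using i(1) by (metis Suc_eq_plus1 mult.assoc power_Suc)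
  also have "\<dots> = a ^ j" using assms(4) by (simp add: left_diff_distrib)
  finally show ?thesis using i(2,3) unfolding left_drazin_identities_def by blast
qed

lemma splitting_right_drazin_identities:
  assumes "e * e = e" "a * e = e * a" "a * y = 1 - e" "a ^ j * e = 0"
  shows "\<exists>y. right_drazin_identities a y j"
proof -
  note i = right_splitting_identities[OF assms(1-3)]
  have "a ^ (j + 1) * ((1 - e) * y * (1 - e)) = a ^ j * (1 - e)"
    using i(1) by (metis Suc_eq_plus1 mult.assoc power_Suc2)
  also have "\<dots> = a ^ j" using assms(4) by (simp add: right_diff_distrib)
  finally show ?thesis using i(2,3) unfolding right_drazin_identities_def by blast
qed

text \<open>
  The exponents are shifted by one because index \<open>0\<close> means \<open>e = 0\<close>, hence \<open>w = 0\<close> for the small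
  block \<open>w\<close>, whereas \<open>w ^ 0 = 0\<close> never holds.
\<close>

lemma left_drazin_iff:
  "left_drazin_invertible a \<longleftrightarrow> left_splitting (\<lambda>w. \<exists>n. w ^ Suc n = 0) a"
proof
  assume "left_drazin_invertible a"
  then obtain x j where "left_drazin_identities a x j"
    by (auto simp: left_drazin_invertible_def)
  then obtain e where e: "e * e = e" "a * e = e * a" "x * a = 1 - e" "e * a ^ j = 0"
    by (rule left_drazin_identities_splitting)
  have "(e * a) ^ Suc j = e * a ^ j * a"
    using idempotent_times_power(1)[OF e(1,2)] by (simp only: power_Suc2 mult.assoc)
  then show "left_splitting (\<lambda>w. \<exists>n. w ^ Suc n = 0) a"
    using e unfolding left_splitting_def by (metis mult_zero_left)
next
  assume "left_splitting (\<lambda>w. \<exists>n. w ^ Suc n = 0) a"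
  then show "left_drazin_invertible a"
    unfolding left_splitting_def left_drazin_invertible_def
    using splitting_left_drazin_identities idempotent_times_power(1) by metis
qed

lemma right_drazin_iff:
  "right_drazin_invertible a \<longleftrightarrow> right_splitting (\<lambda>w. \<exists>n. w ^ Suc n = 0) a"
proof
  assume "right_drazin_invertible a"
  then obtain y j where "right_drazin_identities a y j"
    by (auto simp: right_drazin_invertible_def)
  then obtain e where e: "e * e = e" "a * e = e * a" "a * y = 1 - e" "a ^ j * e = 0"
    by (rule right_drazin_identities_splitting)
  have "(e * a) ^ Suc j = a * (a ^ j * e)"
    using idempotent_times_power[OF e(1,2)] by (metis mult.assoc power_Suc)
  then show "right_splitting (\<lambda>w. \<exists>n. w ^ Suc n = 0) a"
    using e unfolding right_splitting_def by (metis mult_zero_right)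
next
  assume "right_splitting (\<lambda>w. \<exists>n. w ^ Suc n = 0) a"
  then show "right_drazin_invertible a"
    unfolding right_splitting_def right_drazin_invertible_def
    using splitting_right_drazin_identities idempotent_times_power by metis
qed

lemma left_group_iff: "left_group_invertible a \<longleftrightarrow> left_splitting (\<lambda>w. w = 0) a"
proof
  assume "left_group_invertible a"
  then obtain x where "left_drazin_identities a x 1"
    by (auto simp: left_group_invertible_def)
  then obtain e where "e * e = e" "a * e = e * a" "x * a = 1 - e" "e * a ^ 1 = 0"
    by (rule left_drazin_identities_splitting)
  then show "left_splitting (\<lambda>w. w = 0) a"
    unfolding left_splitting_def by (metis power_one_right)
next
  assume "left_splitting (\<lambda>w. w = 0) a"
  then obtain e x where e: "e * e = e" "a * e = e * a" "x * a = 1 - e" "e * a = 0"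
    by (auto simp: left_splitting_def)
  then show "left_group_invertible a"
    unfolding left_group_invertible_def
    by (intro splitting_left_drazin_identities[OF e(1-3)]) simp
qed

lemma right_group_iff: "right_group_invertible a \<longleftrightarrow> right_splitting (\<lambda>w. w = 0) a"
proof
  assume "right_group_invertible a"
  then obtain y where "right_drazin_identities a y 1"
    by (auto simp: right_group_invertible_def)
  then obtain e where "e * e = e" "a * e = e * a" "a * y = 1 - e" "a ^ 1 * e = 0"
    by (rule right_drazin_identities_splitting)
  then show "right_splitting (\<lambda>w. w = 0) a"
    unfolding right_splitting_def by (metis power_one_right)
next
  assume "right_splitting (\<lambda>w. w = 0) a"
  then obtain e y where e: "e * e = e" "a * e = e * a" "a * y = 1 - e" "e * a = 0"
    by (auto simp: right_splitting_def)
  then show "right_group_invertible a"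
    unfolding right_group_invertible_def
    by (intro splitting_right_drazin_identities[OF e(1-3)]) simp
qed

lemma zero_quasinilpotent: "0 \<in> quasinilpotents"
  using quasinilpotentI[of 0] no_nonzero_spectrum_nilpotent[of 0 0]
  by (simp add: alg_invertible_def)

text \<open>
  This replaces the nonemptiness of the spectrum: if the spectrum of \<open>e * a\<close> were empty, then
  \<open>e * a\<close> would be invertible, and with it its commuting factor \<open>a\<close>.
\<close>

lemma quasinilpotent_part_or_invertible:
  fixes a e :: "'a::complex_unital_banach_algebra"
  assumes "a * e = e * a" "no_nonzero_spectrum (e * a)"
  shows "- (e * a) \<in> quasinilpotents \<or> alg_invertible a"
proof (cases "alg_invertible (e * a)")
  case True
  then show ?thesis using alg_invertible_cancel_commuting assms(1) by metis
next
  case False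
  then have "\<not> alg_invertible (- (e * a))" using alg_invertible_uminus by fastforce
  then show ?thesis using quasinilpotentI no_nonzero_spectrum_uminus assms(2) by blast
qed

lemma left_gen_drazin_iff:
  "left_gen_drazin_invertible a \<longleftrightarrow> left_splitting no_nonzero_spectrum a"
proof
  assume "left_gen_drazin_invertible a"
  then obtain x where i: "a * x * a = x * a\<^sup>2" "x\<^sup>2 * a = x" "a * x * a - a \<in> quasinilpotents"
    by (auto simp: left_gen_drazin_invertible_def)
  then show "left_splitting no_nonzero_spectrum a"
    unfolding left_splitting_def
    using left_identities_splitting[OF i(1,2)]
      no_nonzero_spectrum_uminus[OF quasinilpotent_no_nonzero_spectrum[OF i(3)]]
    by metis
next
  assume "left_splitting no_nonzero_spectrum a"
  then obtain e x where e: "e * e = e" "a * e = e * a" "x * a = 1 - e"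
    and q: "no_nonzero_spectrum (e * a)"
    by (auto simp: left_splitting_def)
  from quasinilpotent_part_or_invertible[OF e(2) q] show "left_gen_drazin_invertible a"
  proof
    assume "- (e * a) \<in> quasinilpotents"
    moreover note i = left_splitting_identities[OF e]
    moreover have "a * ((1 - e) * x * (1 - e)) * a - a = - (e * a)"
      using i(1) e(2) by (simp only: mult.assoc) (simp add: right_diff_distrib)
    ultimately show ?thesis unfolding left_gen_drazin_invertible_def by metis
  next
    assume "alg_invertible a"
    then obtain b where "a * b = 1" "b * a = 1" unfolding alg_invertible_def by blast
    then have "a * b * a = b * a\<^sup>2" "b\<^sup>2 * a = b" "a * b * a - a = 0"
      by (simp_all add: power2_eq_square mult.assoc) (simp_all add: mult.assoc[symmetric])
    then show ?thesis unfolding left_gen_drazin_invertible_def using zero_quasinilpotent by metis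
  qed
qed

lemma right_gen_drazin_iff:
  "right_gen_drazin_invertible a \<longleftrightarrow> right_splitting no_nonzero_spectrum a"
proof
  assume "right_gen_drazin_invertible a"
  then obtain y where i: "a * y * a = a\<^sup>2 * y" "a * y\<^sup>2 = y" "a * y * a - a \<in> quasinilpotents"
    by (auto simp: right_gen_drazin_invertible_def)
  then show "right_splitting no_nonzero_spectrum a"
    unfolding right_splitting_def
    using right_identities_splitting[OF i(1,2)]
      no_nonzero_spectrum_uminus[OF quasinilpotent_no_nonzero_spectrum[OF i(3)]]
    by metis
next
  assume "right_splitting no_nonzero_spectrum a"
  then obtain e y where e: "e * e = e" "a * e = e * a" "a * y = 1 - e"
    and q: "no_nonzero_spectrum (e * a)"
    by (auto simp: right_splitting_def)
  from quasinilpotent_part_or_invertible[OF e(2) q] show "right_gen_drazin_invertible a"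
  proof
    assume "- (e * a) \<in> quasinilpotents"
    moreover note i = right_splitting_identities[OF e]
    moreover have "a * ((1 - e) * y * (1 - e)) * a - a = - (e * a)"
      using i(1) by (simp add: left_diff_distrib)
    ultimately show ?thesis unfolding right_gen_drazin_invertible_def by metis
  next
    assume "alg_invertible a"
    then obtain b where "a * b = 1" "b * a = 1" unfolding alg_invertible_def by blast
    then have "a * b * a = a\<^sup>2 * b" "a * b\<^sup>2 = b" "a * b * a - a = 0"
      by (simp_all add: power2_eq_square mult.assoc) (simp_all add: mult.assoc[symmetric])
    then show ?thesis unfolding right_gen_drazin_invertible_def using zero_quasinilpotent by metis
  qed
qed

theorem corollary3p9:
  fixes a c :: "'a::complex_unital_banach_algebra"
  shows "sigma_ld (a * c) - {0} = sigma_ld (c * a) - {0}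
       \<and> sigma_rd (a * c) - {0} = sigma_rd (c * a) - {0}
       \<and> sigma_lg (a * c) - {0} = sigma_lg (c * a) - {0}
       \<and> sigma_rg (a * c) - {0} = sigma_rg (c * a) - {0}
       \<and> sigma_lgd (a * c) - {0} = sigma_lgd (c * a) - {0}
       \<and> sigma_rgd (a * c) - {0} = sigma_rgd (c * a) - {0}"
proof -
  have "left_splitting P (\<mu> *\<^sub>C 1 - a * c) \<longleftrightarrow> left_splitting P (\<mu> *\<^sub>C 1 - c * a)"
    "right_splitting P (\<mu> *\<^sub>C 1 - a * c) \<longleftrightarrow> right_splitting P (\<mu> *\<^sub>C 1 - c * a)"
    if "transportable P" "\<mu> \<noteq> 0" for P :: "'a \<Rightarrow> bool" and \<mu>
    using splitting_transport[OF that] by blast+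
  note swap = this[OF transportable_zero] this[OF transportable_nilpotent]
    this[OF transportable_no_nonzero_spectrum]
  show ?thesis
    unfolding sigma_ld_def sigma_rd_def sigma_lg_def sigma_rg_def sigma_lgd_def sigma_rgd_def
      left_drazin_iff right_drazin_iff left_group_iff right_group_iff
      left_gen_drazin_iff right_gen_drazin_iff
    using swap by blast
qed

end
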